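(* Let $G$ be a group, let $\psi\colon G\to\mathbb{R}$ be a function such that $\delta\psi$ is semi-bounded, and let $f\in G$. If $$\limsup_{k\to\infty}\frac{|\psi(f^k)|}{k}>0,$$ then $f$ is undistorted in $G$.
   Context: $\delta\psi(f,g)=\psi(g)-\psi(fg)+\psi(f)$. It is semi-bounded if for every $f\in G$ one has $\sup_{g\in G}|\delta\psi(f,g)|<\infty$. An element $g$ of a finitely generated group $\Gamma$ is undistorted in $\Gamma$ if $\lim_{k\to\infty}|g^k|/k>0$, where $|\cdot|$ is the word norm with respect to any finite generating set of $\Gamma$. An element $g$ of an arbitrary group $G$ is undistorted if it is undistorted in every finitely generated subgroup $\Gamma\le G$ containing it. *)

theory Defs
  imports "HOL-Algebra.Generated_Groups" "HOL-Library.Extended_Real"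
begin

definition coboundary :: "('a, 'b) monoid_scheme \<Rightarrow> ('a \<Rightarrow> real) \<Rightarrow> 'a \<Rightarrow> 'a \<Rightarrow> real" where
  "coboundary G \<psi> f g = \<psi> g - \<psi> (f \<otimes>\<^bsub>G\<^esub> g) + \<psi> f"

text \<open>The supremum is taken in the extended reals, so that it always exists.\<close>

definition semi_bounded :: "('a, 'b) monoid_scheme \<Rightarrow> ('a \<Rightarrow> 'a \<Rightarrow> real) \<Rightarrow> bool" where
  "semi_bounded G c \<longleftrightarrow> (\<forall>f\<in>carrier G. (SUP g\<in>carrier G. ereal \<bar>c f g\<bar>) < \<infinity>)"

definition finite_generating_set :: "('a, 'b) monoid_scheme \<Rightarrow> 'a set \<Rightarrow> bool" where
  "finite_generating_set \<Gamma> S \<longleftrightarrow> finite S \<and> S \<subseteq> carrier \<Gamma> \<and> generate \<Gamma> S = carrier \<Gamma>"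

definition finitely_generated :: "('a, 'b) monoid_scheme \<Rightarrow> bool" where
  "finitely_generated \<Gamma> \<longleftrightarrow> (\<exists>S. finite_generating_set \<Gamma> S)"

text \<open>The least length of a word in the letters \<open>S\<close> and their inverses that represents \<open>g\<close>;
  only meaningful when \<open>g\<close> lies in the subgroup generated by \<open>S\<close>.\<close>

definition word_norm :: "('a, 'b) monoid_scheme \<Rightarrow> 'a set \<Rightarrow> 'a \<Rightarrow> nat" where
  "word_norm \<Gamma> S g =
    (LEAST n. \<exists>w. length w = n \<and> set w \<subseteq> S \<union> m_inv \<Gamma> ` S \<and> foldr (\<otimes>\<^bsub>\<Gamma>\<^esub>) w \<one>\<^bsub>\<Gamma>\<^esub> = g)"

text \<open>The positivity of the limit does not depend on the finite generating set, so we require it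
  for all of them; finite generation makes the quantifier over \<open>S\<close> nonvacuous.\<close>

definition undistorted_fg :: "('a, 'b) monoid_scheme \<Rightarrow> 'a \<Rightarrow> bool" where
  "undistorted_fg \<Gamma> g \<longleftrightarrow> finitely_generated \<Gamma> \<and> g \<in> carrier \<Gamma> \<and>
    (\<forall>S. finite_generating_set \<Gamma> S \<longrightarrow>
      (\<exists>L>0. (\<lambda>k. real (word_norm \<Gamma> S (g [^]\<^bsub>\<Gamma>\<^esub> (k::nat))) / real k) \<longlonglongrightarrow> L))"

definition undistorted :: "('a, 'b) monoid_scheme \<Rightarrow> 'a \<Rightarrow> bool" where
  "undistorted G g \<longleftrightarrow>
    (\<forall>H. subgroup H G \<longrightarrow> finitely_generated (G\<lparr>carrier := H\<rparr>) \<longrightarrow> g \<in> H \<longrightarrow>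
      undistorted_fg (G\<lparr>carrier := H\<rparr>) g)"

end

(* The idea: if s ranges over a finite set, semi-boundedness gives |psi (s g) - psi g| <= K uniformly
   in s and g, so psi grows at most linearly in the word norm. Hence the limit of |f^k| / k, which
   exists by Fekete's lemma, cannot be 0. *)

theory Submission
  imports Defs
begin

text \<open>Every large n is a multiple of one nearly optimal m plus a bounded remainder, whose
  share of the quotient vanishes. The infimum starts at 1 because division by zero would contribute
  the value 0 at n = 0.\<close>

lemma fekete:
  fixes u :: "nat \<Rightarrow> real"
  assumes sub: "\<And>m n. u (m + n) \<le> u m + u n" and nonneg: "\<And>n. 0 \<le> u n"
  shows "(\<lambda>n. u n / real n) \<longlonglongrightarrow> (INF n\<in>{1..}. u n / real n)"
proof -
  define L where "L = (INF n\<in>{1..}. u n / real n)"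
  have bdd: "bdd_below ((\<lambda>n. u n / real n) ` {1..})"
    by (rule bdd_belowI2[where m = 0]) (simp add: nonneg)
  have lower: "L \<le> u n / real n" if "n \<ge> 1" for n
    unfolding L_def using bdd that by (intro cINF_lower) auto
  have mult: "u (q * m + r) \<le> real q * u m + u r" for q m r
  proof (induction q)
    case (Suc q)
    have "u (Suc q * m + r) \<le> u m + u (q * m + r)"
      using sub[of m "q * m + r"] by (simp add: ac_simps)
    with Suc show ?case by (simp add: algebra_simps)
  qed simp
  have "\<forall>\<^sub>F n in sequentially. dist (u n / real n) L < e" if "e > 0" for e
  proof -
    \<comment> \<open>Half of \<open>e\<close> pays for \<open>m\<close> missing the infimum, the
      other half for the remainder term \<open>M / real n\<close>.\<close>
    have "\<exists>m\<in>{1..}. u m / real m < L + e / 2"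
      using cINF_less_iff[OF _ bdd, of "L + e / 2"] that by (simp add: L_def)
    then obtain m where m: "m \<ge> 1" "u m / real m < L + e / 2" by auto
    \<comment> \<open>One bound for all remainders modulo \<open>m\<close>; since \<open>u\<close>
      is nonnegative, a sum serves as well as a maximum.\<close>
    define M where "M = (\<Sum>r<m. u r)"
    have M: "u r \<le> M" if "r < m" for r
      unfolding M_def using that by (intro member_le_sum) (auto simp: nonneg)
    have upper: "u n / real n \<le> u m / real m + M / real n" if "n \<ge> 1" for n
    proof -
      have "u n \<le> real (n div m) * u m + u (n mod m)"
        using mult[of "n div m" m "n mod m"] by simp
      also have "u (n mod m) \<le> M" using m by (intro M) simp
      also have "real (n div m) * u m \<le> (real n / real m) * u m"
        by (intro mult_right_mono nonneg of_nat_div_le_of_nat)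
      finally show ?thesis using that by (simp add: field_simps)
    qed
    have "(\<lambda>n. M / real n) \<longlonglongrightarrow> 0" by (rule lim_const_over_n)
    then have "\<forall>\<^sub>F n in sequentially. M / real n < e / 2"
      using that by (intro order_tendstoD(2)) auto
    then show ?thesis using eventually_ge_at_top[of 1]
    proof eventually_elim
      case (elim n)
      then show ?case using upper[of n] lower[of n] m(2) unfolding dist_real_def by linarith
    qed
  qed
  then show ?thesis unfolding L_def[symmetric] by (rule tendstoI)
qed

context group
begin

lemma foldr_mult_append:
  assumes "set v \<subseteq> carrier G" "set w \<subseteq> carrier G"
  shows "foldr (\<otimes>) v \<one> \<in> carrier G"
    and "foldr (\<otimes>) (v @ w) \<one> = foldr (\<otimes>) v \<one> \<otimes> foldr (\<otimes>) w \<one>"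
proof -
  have closed: "foldr (\<otimes>) u \<one> \<in> carrier G" if "set u \<subseteq> carrier G" for u
    using that by (induction u) auto
  show "foldr (\<otimes>) v \<one> \<in> carrier G" using closed assms(1) .
  show "foldr (\<otimes>) (v @ w) \<one> = foldr (\<otimes>) v \<one> \<otimes> foldr (\<otimes>) w \<one>"
    using assms by (induction v) (auto simp: closed m_assoc)
qed

lemma letters_in_carrier:
  assumes "finite_generating_set G S"
  shows "S \<union> m_inv G ` S \<subseteq> carrier G"
  using assms by (auto simp: finite_generating_set_def)

text \<open>The rules of \<open>generate\<close> match operations on words: the empty word,
  one-letter words and concatenation. Hence the \<open>LEAST\<close> in \<open>word_norm\<close>
  ranges over a nonempty set.\<close>

lemma exists_word:
  assumes S: "finite_generating_set G S" and g: "g \<in> carrier G"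
  shows "\<exists>w. set w \<subseteq> S \<union> m_inv G ` S \<and> foldr (\<otimes>) w \<one> = g"
proof -
  have "g \<in> generate G S" using S g by (simp add: finite_generating_set_def)
  then show ?thesis
  proof (induction rule: generate.induct)
    case one
    show ?case by (rule exI[of _ "[]"]) simp
  next
    case (incl h)
    then show ?case using letters_in_carrier[OF S] by (intro exI[of _ "[h]"]) auto
  next
    case (inv h)
    then show ?case using letters_in_carrier[OF S] by (intro exI[of _ "[inv h]"]) auto
  next
    case (eng h1 h2)
    then obtain v w where "set v \<subseteq> S \<union> m_inv G ` S" "foldr (\<otimes>) v \<one> = h1"
      "set w \<subseteq> S \<union> m_inv G ` S" "foldr (\<otimes>) w \<one> = h2" by blast
    then show ?case using letters_in_carrier[OF S] foldr_mult_append(2)[of v w]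
      by (intro exI[of _ "v @ w"]) auto
  qed
qed

lemma word_norm_witness:
  assumes "finite_generating_set G S" "g \<in> carrier G"
  obtains w where "length w = word_norm G S g" "set w \<subseteq> S \<union> m_inv G ` S" "foldr (\<otimes>) w \<one> = g"
proof -
  have "\<exists>n w. length w = n \<and> set w \<subseteq> S \<union> m_inv G ` S \<and> foldr (\<otimes>) w \<one> = g"
    using exists_word[OF assms] by blast
  from LeastI_ex[OF this] show ?thesis using that unfolding word_norm_def by blast
qed

lemma word_norm_le_length:
  assumes "set w \<subseteq> S \<union> m_inv G ` S"
  shows "word_norm G S (foldr (\<otimes>) w \<one>) \<le> length w"
  unfolding word_norm_def using assms by (intro Least_le) blast

text \<open>Concatenating shortest words for the factors gives a word for the product, not
  necessarily a shortest one. This is the subadditivity that \<open>fekete\<close> asks for.\<close>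

lemma word_norm_mult_le:
  assumes S: "finite_generating_set G S" and g: "g \<in> carrier G" and h: "h \<in> carrier G"
  shows "word_norm G S (g \<otimes> h) \<le> word_norm G S g + word_norm G S h"
proof -
  obtain v where v: "length v = word_norm G S g" "set v \<subseteq> S \<union> m_inv G ` S" "foldr (\<otimes>) v \<one> = g"
    using word_norm_witness[OF S g] .
  obtain w where w: "length w = word_norm G S h" "set w \<subseteq> S \<union> m_inv G ` S" "foldr (\<otimes>) w \<one> = h"
    using word_norm_witness[OF S h] .
  have "foldr (\<otimes>) (v @ w) \<one> = g \<otimes> h"
    using foldr_mult_append(2)[of v w] v w letters_in_carrier[OF S] by auto
  then show ?thesis using word_norm_le_length[of "v @ w" S] v w by auto
qed

lemma word_norm_pow_tendsto:
  assumes S: "finite_generating_set G S" and g: "g \<in> carrier G"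
  obtains L where "L \<ge> 0" "(\<lambda>k. real (word_norm G S (g [^] (k::nat))) / real k) \<longlonglongrightarrow> L"
proof -
  let ?u = "\<lambda>k::nat. real (word_norm G S (g [^] k))"
  have "?u (m + n) \<le> ?u m + ?u n" for m n
    using word_norm_mult_le[OF S, of "g [^] m" "g [^] n"] g
    by (simp add: nat_pow_mult flip: of_nat_add)
  then have lim: "(\<lambda>k. ?u k / real k) \<longlonglongrightarrow> (INF n\<in>{1..}. ?u n / real n)"
    by (intro fekete) auto
  moreover have "(INF n\<in>{1..}. ?u n / real n) \<ge> 0"
    by (rule LIMSEQ_le_const[OF lim]) auto
  ultimately show ?thesis using that by blast
qed

text \<open>Letters are peeled off the front of a shortest word. The first argument of the
  coboundary is then always one of finitely many letters, while the unbounded rest of the word sits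
  in the second argument, where semi-boundedness is uniform. The empty word leaves the constant
  \<open>\<bar>\<psi> \<one>\<bar>\<close>.\<close>

lemma semi_bounded_linear_growth:
  assumes sb: "semi_bounded G (coboundary G \<psi>)" and S: "finite_generating_set G S"
  obtains K where "K \<ge> 0" "\<And>g. g \<in> carrier G \<Longrightarrow> \<bar>\<psi> g\<bar> \<le> K * real (word_norm G S g) + \<bar>\<psi> \<one>\<bar>"
proof -
  let ?T = "S \<union> m_inv G ` S"
  have "\<exists>C. \<forall>g\<in>carrier G. \<bar>coboundary G \<psi> s g\<bar> \<le> C" if s: "s \<in> carrier G" for s
  proof -
    have "(SUP g\<in>carrier G. ereal \<bar>coboundary G \<psi> s g\<bar>) < \<infinity>"
      using sb s by (simp add: semi_bounded_def)
    then obtain C where C: "(SUP g\<in>carrier G. ereal \<bar>coboundary G \<psi> s g\<bar>) < ereal C"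
      using less_PInf_Ex_of_nat by auto
    have "\<bar>coboundary G \<psi> s g\<bar> \<le> C" if "g \<in> carrier G" for g
      using le_less_trans[OF SUP_upper[OF that] C] by simp
    then show ?thesis by blast
  qed
  then obtain C where C: "\<And>s g. s \<in> carrier G \<Longrightarrow> g \<in> carrier G \<Longrightarrow> \<bar>coboundary G \<psi> s g\<bar> \<le> C s"
    by metis
  \<comment> \<open>Summing over the letters dominates the cost of each of them; the absolute value
    around \<open>C s\<close> makes all summands nonnegative at once.\<close>
  define K where "K = (\<Sum>s\<in>?T. \<bar>\<psi> s\<bar> + \<bar>C s\<bar>)"
  have fin: "finite ?T" using S by (auto simp: finite_generating_set_def)
  have K: "\<bar>\<psi> s\<bar> + \<bar>C s\<bar> \<le> K" if "s \<in> ?T" for s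
    unfolding K_def using fin that by (intro member_le_sum) auto
  have word: "\<bar>\<psi> (foldr (\<otimes>) w \<one>)\<bar> \<le> K * real (length w) + \<bar>\<psi> \<one>\<bar>" if "set w \<subseteq> ?T" for w
    using that
  proof (induction w)
    case (Cons s w)
    let ?g = "foldr (\<otimes>) w \<one>"
    have s: "s \<in> ?T" and w: "set w \<subseteq> ?T" using Cons.prems by auto
    then have "s \<in> carrier G" "?g \<in> carrier G"
      using letters_in_carrier[OF S] by (blast, intro foldr_mult_append(1)) auto
    \<comment> \<open>By definition of the coboundary, \<open>\<psi> (s \<otimes> ?g)\<close> is
      \<open>\<psi> ?g + \<psi> s\<close> minus the coboundary at \<open>s\<close> and
      \<open>?g\<close>.\<close>
    from C[OF this] have "\<bar>\<psi> (s \<otimes> ?g)\<bar> \<le> \<bar>\<psi> ?g\<bar> + (\<bar>\<psi> s\<bar> + \<bar>C s\<bar>)"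
      unfolding coboundary_def by linarith
    with K[OF s] Cons.IH[OF w] show ?case by (simp add: algebra_simps)
  qed simp
  show ?thesis
  proof (rule that)
    show "K \<ge> 0" unfolding K_def by (intro sum_nonneg) auto
    show "\<bar>\<psi> g\<bar> \<le> K * real (word_norm G S g) + \<bar>\<psi> \<one>\<bar>" if "g \<in> carrier G" for g
      using word_norm_witness[OF S that] word by metis
  qed
qed

text \<open>The constant \<open>K\<close> depends on the generating set, which is harmless: only
  \<open>L \<noteq> 0\<close> has to be shown, separately for each \<open>S\<close>.\<close>

lemma undistorted_fg_if_semi_bounded:
  assumes sb: "semi_bounded G (coboundary G \<psi>)" and fg: "finitely_generated G"
    and f: "f \<in> carrier G"
    and pos: "limsup (\<lambda>k. ereal (\<bar>\<psi> (f [^] (k::nat))\<bar> / real k)) > 0"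
  shows "undistorted_fg G f"
  unfolding undistorted_fg_def
proof (intro conjI allI impI)
  fix S assume S: "finite_generating_set G S"
  let ?u = "\<lambda>k::nat. real (word_norm G S (f [^] k))"
  obtain L where L: "L \<ge> 0" "(\<lambda>k. ?u k / real k) \<longlonglongrightarrow> L"
    using word_norm_pow_tendsto[OF S f] .
  obtain K where K: "K \<ge> 0"
    "\<And>g. g \<in> carrier G \<Longrightarrow> \<bar>\<psi> g\<bar> \<le> K * real (word_norm G S g) + \<bar>\<psi> \<one>\<bar>"
    by (rule semi_bounded_linear_growth[OF sb S]) (rule that)
  \<comment> \<open>The additive constant disappears after division by \<open>k\<close>, so the
    upper bound for the quotients of \<open>\<psi>\<close> converges to
    \<open>K * L\<close>.\<close>
  have "(\<lambda>k. K * (?u k / real k) + \<bar>\<psi> \<one>\<bar> / real k) \<longlonglongrightarrow> K * L + 0"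
    by (intro tendsto_intros L lim_const_over_n)
  then have "(\<lambda>k. ereal (K * (?u k / real k) + \<bar>\<psi> \<one>\<bar> / real k)) \<longlonglongrightarrow> ereal (K * L)"
    by simp
  then have "limsup (\<lambda>k. ereal (K * (?u k / real k) + \<bar>\<psi> \<one>\<bar> / real k)) = ereal (K * L)"
    by (intro lim_imp_Limsup) auto
  \<comment> \<open>At \<open>k = 0\<close> both sides are 0 by the convention on division, so the
    comparison holds for every \<open>k\<close>.\<close>
  moreover have "\<bar>\<psi> (f [^] k)\<bar> / real k \<le> K * (?u k / real k) + \<bar>\<psi> \<one>\<bar> / real k" for k
    using divide_right_mono[OF K(2)[of "f [^] k"], of "real k"] f by (simp add: add_divide_distrib)
  then have "limsup (\<lambda>k. ereal (\<bar>\<psi> (f [^] k)\<bar> / real k))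
      \<le> limsup (\<lambda>k. ereal (K * (?u k / real k) + \<bar>\<psi> \<one>\<bar> / real k))"
    by (intro Limsup_mono always_eventually) simp
  ultimately have "0 < ereal (K * L)" using pos by (metis order.strict_trans2)
  then have "L \<noteq> 0" by auto
  then show "\<exists>L>0. (\<lambda>k. ?u k / real k) \<longlonglongrightarrow> L" using L by (intro exI[of _ L]) auto
qed (fact fg f)+

end

text \<open>The product of the subgroup is that of \<open>G\<close>, so the coboundary has the same
  values and each supremum is merely taken over a smaller set.\<close>

lemma semi_bounded_subgroup:
  assumes "semi_bounded G (coboundary G \<psi>)" and "subgroup H G"
  shows "semi_bounded (G\<lparr>carrier := H\<rparr>) (coboundary (G\<lparr>carrier := H\<rparr>) \<psi>)"
proof -
  have H: "H \<subseteq> carrier G" using assms(2) by (rule subgroup.subset)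
  have "(SUP g\<in>H. ereal \<bar>coboundary G \<psi> f g\<bar>) < \<infinity>" if "f \<in> H" for f
    using assms(1) H that
    by (intro le_less_trans[OF SUP_subset_mono[OF H order_refl]]) (auto simp: semi_bounded_def)
  then show ?thesis by (simp add: semi_bounded_def coboundary_def)
qed

theorem theorem1p6:
  fixes G :: "('a, 'b) monoid_scheme" and \<psi> :: "'a \<Rightarrow> real" and f :: 'a
  assumes "group G"
    and "semi_bounded G (coboundary G \<psi>)"
    and "f \<in> carrier G"
    and "limsup (\<lambda>k. ereal (\<bar>\<psi> (f [^]\<^bsub>G\<^esub> (k::nat))\<bar> / real k)) > 0"
  shows "undistorted G f"
  unfolding undistorted_def
proof (intro allI impI)
  interpret group G by fact
  fix H assume H: "subgroup H G" and fg: "finitely_generated (G\<lparr>carrier := H\<rparr>)" and f: "f \<in> H"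
  show "undistorted_fg (G\<lparr>carrier := H\<rparr>) f"
  proof (rule group.undistorted_fg_if_semi_bounded)
    show "group (G\<lparr>carrier := H\<rparr>)" using H by (rule subgroup_imp_group)
    show "semi_bounded (G\<lparr>carrier := H\<rparr>) (coboundary (G\<lparr>carrier := H\<rparr>) \<psi>)"
      using assms(2) H by (rule semi_bounded_subgroup)
    \<comment> \<open>Powers of \<open>f\<close> are the same in \<open>H\<close> and in
      \<open>G\<close>, so the growth hypothesis carries over unchanged.\<close>
    show "limsup (\<lambda>k. ereal (\<bar>\<psi> (f [^]\<^bsub>G\<lparr>carrier := H\<rparr>\<^esub> (k::nat))\<bar> / real k)) > 0"
      using assms(4) by (simp flip: nat_pow_consistent)
  qed (use fg f in auto)
qed

end
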